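(* For every odd $k\in\{3,5,\dots,51\}$, $$\alpha\big(f_{\{(k+1)/2\},k}\big)=\binom{k}{(k+1)/2}\left(\frac{k-1}{2k}(1-p'_k)^{(k+1)/2}(p'_k)^{(k-1)/2}+\frac{k+1}{2k}(1-p'_k)^{(k-1)/2}(p'_k)^{(k+1)/2}\right),$$ where $p'_k=\frac{3k-k^2+\sqrt{4k+k^2-2k^3+k^4}}{4k}$.
   Context: For $S\subseteq\{0,\dots,k\}$, $f_{S,k}:\mathbb Z_2^k\to\{0,1\}$ is the symmetric predicate with $f_{S,k}(\mathbf a)=1$ iff the Hamming weight $\|\mathbf a\|_0\in S$. $\mathcal B_p$ is the distribution on $\{0,1\}$ giving $0$ probability $p$ and $1$ probability $1-p$. For $f:\mathbb Z_2^k\to\{0,1\}$ and a distribution $\mathcal D$ on $\mathbb Z_2^k$: $\lambda_f(\mathcal D,p)=\mathbb E_{\mathbf b\sim\mathcal D,\mathbf a\sim\mathcal B_p^k}[f(\mathbf a+\mathbf b)]$, $\gamma_f(\mathcal D)=\lambda_f(\mathcal D,1)$, $\beta_f(\mathcal D)=\sup_{p\in[0,1]}\lambda_f(\mathcal D,p)$, $\boldsymbol\mu(\mathcal D)_i=-\mathbb E_{\mathbf a\sim\mathcal D}[(-1)^{a_i}]$, and $\alpha(f)=\inf\{\beta_f(\mathcal D_N)/\gamma_f(\mathcal D_Y):\boldsymbol\mu(\mathcal D_N)=\boldsymbol\mu(\mathcal D_Y)\}$ over pairs of distributions on $\mathbb Z_2^k$ (zero denominators read as $+\infty$). *)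

theory Defs
  imports "HOL-Probability.Probability" "HOL-Library.Z2"
begin

text \<open>
  The group \<open>\<int>\<^sub>2\<^sup>k\<close> is the type \<open>bit ^ 'n\<close> with \<open>CARD('n) = k\<close>, where \<open>bit\<close> is the field with two
  elements. A predicate \<open>f : \<int>\<^sub>2\<^sup>k \<rightarrow> {0,1}\<close> is a \<open>bool\<close>-valued function; \<open>of_bool\<close> gives its 0/1 value.
\<close>

instance bit :: finite
proof
  have "(UNIV :: bit set) = {0, 1}"
    by auto
  then show "finite (UNIV :: bit set)"
    by (metis finite.emptyI finite.insertI)
qed

definition hamming_weight :: "bit ^ 'n \<Rightarrow> nat" where
  "hamming_weight a = card {i. a $ i = 1}"

definition sym_pred :: "nat set \<Rightarrow> bit ^ 'n \<Rightarrow> bool" where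
  "sym_pred S a \<longleftrightarrow> hamming_weight a \<in> S"

text \<open>The parameter \<open>p\<close> is the probability of \<open>0\<close>, not of \<open>1\<close>.\<close>

definition B_pmf :: "real \<Rightarrow> bit pmf" where
  "B_pmf p = map_pmf (\<lambda>h. if h then 0 else 1) (bernoulli_pmf p)"

definition B_vec_pmf :: "real \<Rightarrow> (bit ^ 'n) pmf" where
  "B_vec_pmf p = map_pmf vec_lambda (Pi_pmf UNIV 0 (\<lambda>_. B_pmf p))"

definition lam :: "(bit ^ 'n \<Rightarrow> bool) \<Rightarrow> (bit ^ 'n) pmf \<Rightarrow> real \<Rightarrow> real" where
  "lam f D p = measure_pmf.expectation (pair_pmf D (B_vec_pmf p)) (\<lambda>(b, a). of_bool (f (a + b)))"

definition gam :: "(bit ^ 'n \<Rightarrow> bool) \<Rightarrow> (bit ^ 'n) pmf \<Rightarrow> real" where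
  "gam f D = lam f D 1"

definition bet :: "(bit ^ 'n \<Rightarrow> bool) \<Rightarrow> (bit ^ 'n) pmf \<Rightarrow> real" where
  "bet f D = (SUP p\<in>{0..1}. lam f D p)"

definition mu :: "(bit ^ 'n) pmf \<Rightarrow> real ^ 'n" where
  "mu D = (\<chi> i. - measure_pmf.expectation D (\<lambda>a. (- 1) ^ of_bool (a $ i = 1)))"

text \<open>
  The infimum is taken in the extended reals. The case distinction is needed because \<open>0 / 0 = 0\<close>
  in \<^typ>\<open>ereal\<close>, whereas here every ratio with denominator zero is \<open>\<infinity>\<close>.
\<close>

definition alpha :: "(bit ^ 'n \<Rightarrow> bool) \<Rightarrow> ereal" where
  "alpha f = (INF (D\<^sub>N, D\<^sub>Y) \<in> {(D\<^sub>N, D\<^sub>Y). mu D\<^sub>N = mu D\<^sub>Y}.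
     if gam f D\<^sub>Y = 0 then \<infinity> else ereal (bet f D\<^sub>N / gam f D\<^sub>Y))"

definition p' :: "nat \<Rightarrow> real" where
  "p' k = (3 * real k - real k ^ 2 + sqrt (4 * real k + real k ^ 2 - 2 * real k ^ 3 + real k ^ 4))
          / (4 * real k)"

end

theory Submission
  imports Defs "HOL-Computational_Algebra.Polynomial"
begin

text \<open>
  Write \<open>k = 2n + 3\<close>, so that the predicate asks for weight \<open>n + 2\<close>, and let \<open>P\<^sub>p(i)\<close> be the
  probability that a vector of weight \<open>i\<close> has weight \<open>n + 2\<close> after adding \<open>\<B>\<^sub>p\<close> noise. It is the
  coefficient of \<open>x\<close> to the \<open>n + 2\<close> in \<open>(q + p x)\<^sup>i (p + q x)\<^bsup>k - i\<^esup>\<close>, where \<open>q = 1 - p\<close>.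

  Upper bound: let \<open>D\<^sub>Y\<close> be uniform on the vectors of weight \<open>n + 2\<close>, and \<open>D\<^sub>N\<close> the mixture of the all-zeros and
  the all-ones vector with the same marginals. Then \<open>\<lambda>(D\<^sub>N, p)\<close> is a multiple of
  \<open>(1 - t\<^sup>2)\<^bsup>n + 1\<^esup> (k + t)\<close> with \<open>t = 2p - 1\<close>, and \<open>p'\<^sub>k\<close> is its maximiser.

  Lower bound: at \<open>p = p'\<^sub>k\<close> the function \<open>P\<^sub>p\<close> is concave in \<open>i\<close>, so it lies above the chord through
  \<open>i = 0\<close> and \<open>i = k\<close>. The expectation of the chord is determined by the marginals and hence agrees for
  \<open>D\<^sub>N\<close> and \<open>D\<^sub>Y\<close>; the chord is nonnegative, and its value at \<open>n + 2\<close> is the claimed constant.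
  Concavity holds for every \<open>p\<close> with \<open>1/2 \<le> p \<le> (n + 2) / k\<close>: the second difference of \<open>P\<^sub>p\<close> is, up to
  the factor \<open>(p - q)\<^sup>2\<close>, the second difference at the centre of the law of a sum of \<open>k - 2\<close>
  independent Bernoulli variables with means \<open>p\<close> and \<open>q\<close>.
\<close>

section \<open>Discrete concavity\<close>

text \<open>The increments \<open>d\<close> decrease, so those before \<open>i\<close> are all at
  least \<open>d i\<close> and those from \<open>i\<close> on are at most \<open>d i\<close>.
  Comparing the two averages through \<open>d i\<close> and clearing denominators gives the chord
  inequality.\<close>

lemma discrete_concave_above_chord:
  fixes f :: "nat \<Rightarrow> real"
  assumes concave: "\<And>i. Suc i < k \<Longrightarrow> f (Suc (Suc i)) + f i \<le> 2 * f (Suc i)"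
    and "i \<le> k"
  shows "real (k - i) * f 0 + real i * f k \<le> real k * f i"
proof -
  define d where "d j = f (Suc j) - f j" for j
  have d_Suc: "d (Suc j) \<le> d j" if "Suc j < k" for j
    using concave[OF that] by (simp add: d_def)
  have d_antimono: "d l \<le> d j" if "j \<le> l" "l < k" for j l
    using that by (induction l rule: dec_induct) (auto intro: order_trans[OF d_Suc])
  have tele: "f (j + r) = f j + (\<Sum>l<r. d (j + l))" for j r
    by (induction r) (auto simp: d_def)
  show ?thesis
  proof (cases "i = 0 \<or> i = k")
    case True
    then show ?thesis by auto
  next
    case False
    then have i: "0 < i" "i < k" using \<open>i \<le> k\<close> by auto
    have "real i * d i \<le> (\<Sum>l<i. d l)"
      using sum_mono[of "{..<i}" "\<lambda>_. d i" d] d_antimono i by auto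
    then have left: "real i * d i \<le> f i - f 0"
      using tele[of 0 i] by simp
    have "(\<Sum>l<k - i. d (i + l)) \<le> real (k - i) * d i"
      using sum_mono[of "{..<k - i}" "\<lambda>l. d (i + l)" "\<lambda>_. d i"] d_antimono i by auto
    then have right: "f k - f i \<le> real (k - i) * d i"
      using tele[of i "k - i"] i by simp
    have "real i * (f k - f i) \<le> real (k - i) * (real i * d i)"
      using mult_left_mono[OF right, of "real i"] by (simp add: algebra_simps)
    also have "\<dots> \<le> real (k - i) * (f i - f 0)"
      using left by (intro mult_left_mono) auto
    finally show ?thesis
      using i by (simp add: algebra_simps of_nat_diff)
  qed
qed

section \<open>Generating polynomials of Bernoulli sums and concavity of their coefficients\<close>

lemma coeff_mult_nonneg:
  fixes P Q :: "real poly"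
  assumes "\<And>i. 0 \<le> coeff P i" "\<And>i. 0 \<le> coeff Q i"
  shows "0 \<le> coeff (P * Q) j"
  using assms by (auto simp: coeff_mult intro!: sum_nonneg)

lemma coeff_power_nonneg:
  fixes P :: "real poly"
  assumes "\<And>i. 0 \<le> coeff P i"
  shows "0 \<le> coeff (P ^ r) j"
proof (induction r arbitrary: j)
  case (Suc r)
  then show ?case using assms by (auto intro: coeff_mult_nonneg)
qed simp

text \<open>The generating polynomial of a sum of \<open>a\<close> Bernoulli variables of mean \<open>p\<close> and \<open>b\<close> of mean \<open>q\<close>.\<close>

definition gen_poly :: "real \<Rightarrow> real \<Rightarrow> nat \<Rightarrow> nat \<Rightarrow> real poly" where
  "gen_poly p q a b = [:q, p:] ^ a * [:p, q:] ^ b"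

lemma coeff_gen_poly_nonneg:
  assumes "0 \<le> p" "0 \<le> q"
  shows "0 \<le> coeff (gen_poly p q a b) j"
  unfolding gen_poly_def
  using assms by (intro coeff_mult_nonneg coeff_power_nonneg) (auto simp: coeff_pCons split: nat.split)

text \<open>Both weighted coefficients are sums over the variable that is left out; in each summand the
  odds lie between \<open>q / p\<close> and \<open>p / q\<close>.\<close>

lemma coeff_gen_poly_drop:
  fixes p q :: real and a b j :: nat
  defines "A \<equiv> coeff (gen_poly p q (a - 1) b) j" and "B \<equiv> coeff (gen_poly p q a (b - 1)) j"
  shows "(real j + 1) * coeff (gen_poly p q a b) (Suc j) = a * p * A + b * q * B"
    and "(real a + real b - real j) * coeff (gen_poly p q a b) j = a * q * A + b * p * B"
proof -
  define G where "G = gen_poly p q a b"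
  define GA where "GA = gen_poly p q (a - 1) b"
  define GB where "GB = gen_poly p q a (b - 1)"
  \<comment> \<open>The scalar \<open>a\<close> covers the case \<open>a = 0\<close>, where
    \<open>a - 1\<close> is truncated to 0 and no factor can be split off.\<close>
  have aG: "smult (real a) G = smult (real a) ([:q, p:] * GA)"
    by (cases a) (simp_all add: G_def GA_def gen_poly_def mult.assoc del: mult_pCons_left)
  have bG: "smult (real b) G = smult (real b) ([:p, q:] * GB)"
    by (cases b) (simp_all add: G_def GB_def gen_poly_def mult.left_commute del: mult_pCons_left mult_pCons_right)
  have deriv: "pderiv G = smult (a * p) GA + smult (b * q) GB"
    unfolding G_def GA_def GB_def gen_poly_def
    by (simp add: pderiv_mult pderiv_power pderiv_pCons mult_ac)
  have "(real j + 1) * coeff G (Suc j) = coeff (pderiv G) j"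
    by (simp add: coeff_pderiv)
  then show "(real j + 1) * coeff (gen_poly p q a b) (Suc j) = a * p * A + b * q * B"
    unfolding deriv by (simp add: A_def B_def G_def GA_def GB_def)
  \<comment> \<open>The weight \<open>j\<close> comes from \<open>x\<close> times the derivative.
    Subtracting this from \<open>a\<close> and \<open>b\<close> copies of \<open>G\<close>, each
    with one factor split off, cancels the shifted coefficients.\<close>
  have "real j * coeff G j = coeff (pCons 0 (pderiv G)) j"
    by (cases j) (auto simp: coeff_pderiv)
  also have "pCons 0 (pderiv G) = smult (a * p) (pCons 0 GA) + smult (b * q) (pCons 0 GB)"
    unfolding deriv by simp
  finally have j: "real j * coeff G j = a * p * coeff (pCons 0 GA) j + b * q * coeff (pCons 0 GB) j"
    by (simp only: coeff_add coeff_smult)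
  have linear: "coeff ([:c, d:] * Q) j = c * coeff Q j + d * coeff (pCons 0 Q) j" for c d :: real and Q
    by (cases j) simp_all
  have "real a * coeff G j = a * q * coeff GA j + a * p * coeff (pCons 0 GA) j"
    using arg_cong[OF aG, of "\<lambda>P. coeff P j"] unfolding coeff_smult linear by (simp add: algebra_simps)
  moreover have "real b * coeff G j = b * p * coeff GB j + b * q * coeff (pCons 0 GB) j"
    using arg_cong[OF bG, of "\<lambda>P. coeff P j"] unfolding coeff_smult linear by (simp add: algebra_simps)
  ultimately show "(real a + real b - real j) * coeff (gen_poly p q a b) j = a * q * A + b * p * B"
    using j by (simp add: A_def B_def G_def GA_def GB_def algebra_simps)
qed

text \<open>After both sides are expanded by \<open>coeff_gen_poly_drop\<close>, one of the two
  summands agrees on both sides and the other is multiplied by \<open>q * q\<close> on the left and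
  \<open>p * p\<close> on the right.\<close>

lemma coeff_gen_poly_ratio:
  fixes p q :: real and a b j :: nat
  assumes "0 \<le> q" "q \<le> p"
  defines "G \<equiv> gen_poly p q a b"
  shows "q * ((real j + 1) * coeff G (Suc j)) \<le> p * ((real a + real b - real j) * coeff G j)"
    and "q * ((real a + real b - real j) * coeff G j) \<le> p * ((real j + 1) * coeff G (Suc j))"
proof -
  define A where "A = coeff (gen_poly p q (a - 1) b) j"
  define B where "B = coeff (gen_poly p q a (b - 1)) j"
  have nonneg: "0 \<le> a * A" "0 \<le> b * B"
    using assms by (auto simp: A_def B_def intro!: mult_nonneg_nonneg coeff_gen_poly_nonneg)
  have sq: "q * q \<le> p * p"
    using assms by (intro mult_mono) auto
  have "q * q * (a * A) \<le> p * p * (a * A)" "q * q * (b * B) \<le> p * p * (b * B)"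
    using sq nonneg by (auto intro: mult_right_mono)
  then have "q * (a * p * A + b * q * B) \<le> p * (a * q * A + b * p * B)"
    and "q * (a * q * A + b * p * B) \<le> p * (a * p * A + b * q * B)"
    by (simp_all add: algebra_simps)
  then show "q * ((real j + 1) * coeff G (Suc j)) \<le> p * ((real a + real b - real j) * coeff G j)"
    and "q * ((real a + real b - real j) * coeff G j) \<le> p * ((real j + 1) * coeff G (Suc j))"
    unfolding G_def coeff_gen_poly_drop A_def B_def .
qed

text \<open>The ratio bounds at \<open>n + 1\<close> and \<open>n\<close> make the outer
  coefficients at most \<open>n p / ((n + 2) q)\<close> and \<open>p / q\<close> times the central
  one. The sum of these factors is \<open>2 (n + 1) p / ((n + 2) q)\<close>, which \<open>np\<close>
  bounds by 2. For \<open>q = 1 - p\<close>, \<open>np\<close> says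
  \<open>(2 n + 3) p \<le> n + 2\<close>.\<close>

lemma coeff_gen_poly_central_concave:
  fixes p q :: real and a b n :: nat
  assumes "0 < q" "q \<le> p" and ab: "a + b = 2 * n + 1" and np: "(n + 1) * p \<le> (n + 2) * q"
  defines "G \<equiv> gen_poly p q a b"
  shows "coeff G (n + 2) + coeff G n \<le> 2 * coeff G (n + 1)"
proof -
  have ab': "real a + real b = 2 * n + 1"
    using ab by linarith
  have pos: "0 \<le> coeff G (n + 1)"
    unfolding G_def using assms by (intro coeff_gen_poly_nonneg) auto
  have 1: "q * ((n + 2) * coeff G (n + 2)) \<le> p * (n * coeff G (n + 1))"
    using coeff_gen_poly_ratio(1)[of q p "n + 1" a b] assms(1,2) unfolding ab' G_def by (simp add: algebra_simps)
  have "(n + 1) * (q * coeff G n) \<le> (n + 1) * (p * coeff G (n + 1))"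
    using coeff_gen_poly_ratio(2)[of q p a b n] assms(1,2) unfolding ab' G_def by (simp add: algebra_simps)
  then have 2: "q * coeff G n \<le> p * coeff G (n + 1)"
    by (subst (asm) mult_le_cancel_left_pos) auto
  have "(n + 2) * (q * coeff G n) \<le> (n + 2) * (p * coeff G (n + 1))"
    by (rule mult_left_mono[OF 2]) simp
  with 1 have "((n + 2) * q) * (coeff G (n + 2) + coeff G n) \<le> 2 * ((n + 1) * p * coeff G (n + 1))"
    by (simp add: algebra_simps)
  also have "\<dots> \<le> 2 * ((n + 2) * q * coeff G (n + 1))"
    using np pos by (intro mult_left_mono mult_right_mono) auto
  finally have "((n + 2) * q) * (coeff G (n + 2) + coeff G n) \<le> ((n + 2) * q) * (2 * coeff G (n + 1))"
    by (simp add: algebra_simps)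
  then show ?thesis
    using \<open>0 < q\<close> by (subst (asm) mult_le_cancel_left_pos) auto
qed

text \<open>With the common part factored out, the left side is a perfect square: the difference of
  the factors \<open>q + p x\<close> and \<open>p + q x\<close> is
  \<open>(q - p) (1 - x)\<close>.\<close>

lemma gen_poly_second_difference:
  "gen_poly p q (Suc (Suc a)) b + gen_poly p q a (Suc (Suc b)) - smult 2 (gen_poly p q (Suc a) (Suc b)) =
   smult ((p - q)\<^sup>2) (gen_poly p q a b * [:1, - 2, 1:])"
proof -
  have "gen_poly p q (Suc (Suc a)) b + gen_poly p q a (Suc (Suc b)) - smult 2 (gen_poly p q (Suc a) (Suc b)) =
    gen_poly p q a b * ([:q, p:] * [:q, p:] + [:p, q:] * [:p, q:] - smult 2 ([:q, p:] * [:p, q:]))"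
    unfolding gen_poly_def power_Suc by (simp only: algebra_simps mult_smult_left mult_smult_right)
  also have "[:q, p:] * [:q, p:] + [:p, q:] * [:p, q:] - smult 2 ([:q, p:] * [:p, q:]) =
    smult ((p - q)\<^sup>2) [:1, - 2, 1:]"
    by (simp add: power2_eq_square algebra_simps)
  finally show ?thesis by (simp only: mult_smult_right)
qed

text \<open>Multiplication by \<open>(1 - x)\<^sup>2\<close> turns the second difference in the
  number of factors into the second difference of the coefficients of \<open>G\<close>, centred at
  \<open>n + 1\<close>.\<close>

lemma coeff_gen_poly_concave:
  fixes p q :: real and a b n :: nat
  assumes "0 < q" "q \<le> p" and ab: "a + b = 2 * n + 1" and np: "(n + 1) * p \<le> (n + 2) * q"
  shows "coeff (gen_poly p q (Suc (Suc a)) b) (n + 2) + coeff (gen_poly p q a (Suc (Suc b))) (n + 2)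
    \<le> 2 * coeff (gen_poly p q (Suc a) (Suc b)) (n + 2)"
proof -
  define G where "G = gen_poly p q a b"
  have "coeff (G * [:1, - 2, 1:]) (n + 2) = coeff G (n + 2) - 2 * coeff G (n + 1) + coeff G n"
    by (simp add: algebra_simps)
  also have "\<dots> \<le> 0"
    using coeff_gen_poly_central_concave[OF assms] by (simp add: G_def)
  finally have "(p - q)\<^sup>2 * coeff (G * [:1, - 2, 1:]) (n + 2) \<le> 0"
    by (simp add: mult_nonneg_nonpos)
  then have "coeff (smult ((p - q)\<^sup>2) (G * [:1, - 2, 1:])) (n + 2) \<le> 0"
    by (simp only: coeff_smult)
  then show ?thesis
    unfolding G_def gen_poly_second_difference[symmetric] by simp
qed

section \<open>Expansion over subsets, and counting vectors through their supports\<close>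

text \<open>In the expanded product, \<open>X\<close> is the set of factors that contribute their
  linear term.\<close>

lemma prod_linear_poly_coeff:
  fixes f g :: "'i \<Rightarrow> 'a::comm_semiring_1"
  assumes "finite I"
  shows "coeff (\<Prod>i\<in>I. [:g i, f i:]) m = (\<Sum>X | X \<subseteq> I \<and> card X = m. (\<Prod>i\<in>I. if i \<in> X then f i else g i))"
proof -
  have mon: "(\<Prod>i\<in>X. monom (f i) 1) = monom (\<Prod>i\<in>X. f i) (card X)" if "finite X" for X
    using that by (induction X) (auto simp: mult_monom one_pCons monom_0)
  have const: "(\<Prod>i\<in>X. [:g i:]) = [:\<Prod>i\<in>X. g i:]" if "finite X" for X
    using that by (induction X) (auto simp: one_pCons mult.commute)
  have split: "(\<Prod>i\<in>I. if i \<in> X then f i else g i) = (\<Prod>i\<in>X. f i) * (\<Prod>i\<in>I - X. g i)" if "X \<subseteq> I" for X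
    using assms that by (subst prod.If_cases) (auto simp: Int_absorb1 Diff_eq Int_commute intro!: arg_cong2[of _ _ _ _ "(*)"] prod.cong)
  have "(\<Prod>i\<in>I. [:g i, f i:]) = (\<Prod>i\<in>I. monom (f i) 1 + [:g i:])"
    by (intro prod.cong) (auto simp: monom_altdef)
  also have "\<dots> = (\<Sum>X\<in>Pow I. (\<Prod>i\<in>X. monom (f i) 1) * (\<Prod>i\<in>I - X. [:g i:]))"
    by (rule prod_add[OF assms])
  also have "\<dots> = (\<Sum>X\<in>Pow I. smult (\<Prod>i\<in>I - X. g i) (monom (\<Prod>i\<in>X. f i) (card X)))"
    using assms by (intro sum.cong refl) (auto simp: mon const finite_subset simp del: One_nat_def)
  finally have "coeff (\<Prod>i\<in>I. [:g i, f i:]) m =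
      (\<Sum>X\<in>Pow I. if card X = m then (\<Prod>i\<in>I. if i \<in> X then f i else g i) else 0)"
    by (auto simp: coeff_sum split mult.commute intro!: sum.cong)
  also have "\<dots> = (\<Sum>X | X \<subseteq> I \<and> card X = m. (\<Prod>i\<in>I. if i \<in> X then f i else g i))"
    using assms by (subst sum.inter_filter[symmetric]) (auto intro!: sum.cong)
  finally show ?thesis .
qed

definition supp :: "bit ^ 'n \<Rightarrow> 'n set" where
  "supp a = {i. a $ i = 1}"

lemma hamming_weight_supp: "hamming_weight a = card (supp a)"
  by (simp add: hamming_weight_def supp_def)

lemma bij_supp: "bij (supp :: bit ^ 'n \<Rightarrow> _)"
proof (rule bijI)
  show "inj (supp :: bit ^ 'n \<Rightarrow> _)"
  proof (rule injI)
    fix a b :: "bit ^ 'n"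
    assume "supp a = supp b"
    then have "(a $ i = 1) = (b $ i = 1)" for i
      unfolding supp_def by blast
    then show "a = b"
      by (metis bit_not_one_iff vec_eq_iff)
  qed
  have "supp (\<chi> i. (of_bool (i \<in> X) :: bit)) = X" for X :: "'n set"
    by (auto simp: supp_def)
  then show "surj (supp :: bit ^ 'n \<Rightarrow> _)"
    by (metis surjI)
qed

lemma hamming_weight_le: "hamming_weight (a :: bit ^ 'n) \<le> CARD('n)"
  by (simp add: hamming_weight_def card_mono)

lemma card_supp_Collect:
  "card {a :: bit ^ 'n. P (supp a)} = card {X. P X}"
proof -
  have "supp ` {a :: bit ^ 'n. P (supp a)} = {X. P X}"
  proof (rule set_eqI)
    fix X :: "'n set"
    obtain a :: "bit ^ 'n" where "X = supp a"
      using surjD[OF bij_is_surj[OF bij_supp]] by blast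
    then show "X \<in> supp ` {a :: bit ^ 'n. P (supp a)} \<longleftrightarrow> X \<in> {X. P X}"
      by auto
  qed
  then have "bij_betw supp {a :: bit ^ 'n. P (supp a)} {X. P X}"
    by (intro bij_betw_subset[OF bij_supp]) auto
  then show ?thesis
    by (rule bij_betw_same_card)
qed

lemma card_hamming_weight_eq: "card {a :: bit ^ 'n. hamming_weight a = m} = CARD('n) choose m"
  using card_supp_Collect[of "\<lambda>X :: 'n set. card X = m"] n_subsets[of "UNIV :: 'n set" m]
  by (simp add: hamming_weight_supp)

text \<open>This count yields the marginals of the uniform distribution on a weight layer. With the
  coordinate fixed to 0, all \<open>m\<close> ones lie among the other coordinates.\<close>

lemma card_hamming_weight_eq_nth_zero:
  "card {a :: bit ^ 'n. hamming_weight a = m \<and> a $ i = 0} = (CARD('n) - 1) choose m"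
proof -
  have "{a :: bit ^ 'n. hamming_weight a = m \<and> a $ i = 0} = {a. card (supp a) = m \<and> i \<notin> supp a}"
    by (auto simp: hamming_weight_supp) (auto simp: supp_def)
  also have "card \<dots> = card {X :: 'n set. card X = m \<and> i \<notin> X}"
    by (rule card_supp_Collect)
  also have "{X :: 'n set. card X = m \<and> i \<notin> X} = {X. X \<subseteq> UNIV - {i} \<and> card X = m}"
    by auto
  also have "card \<dots> = (CARD('n) - 1) choose m"
    by (subst n_subsets) auto
  finally show ?thesis .
qed

section \<open>The noise distribution, its effect on the weight, and the marginals\<close>

lemma pmf_B_pmf:
  assumes "0 \<le> p" "p \<le> 1"
  shows "pmf (B_pmf p) x = (if x = 0 then p else 1 - p)"
proof -
  have inj: "inj (\<lambda>h. if h then 0 else 1 :: bit)"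
    by (auto simp: inj_def)
  show ?thesis
    using pmf_map_inj'[OF inj, of "bernoulli_pmf p" True] pmf_map_inj'[OF inj, of "bernoulli_pmf p" False] assms
    by (cases x) (auto simp: B_pmf_def)
qed

lemma pmf_B_vec_pmf:
  fixes a :: "bit ^ 'n"
  assumes "0 \<le> p" "p \<le> 1"
  shows "pmf (B_vec_pmf p) a = (\<Prod>i\<in>UNIV. if a $ i = 0 then p else 1 - p)"
proof -
  have inj: "inj (vec_lambda :: ('n \<Rightarrow> bit) \<Rightarrow> _)"
    by (metis injI vec_lambda_inverse UNIV_I)
  have "pmf (B_vec_pmf p) a = pmf (B_vec_pmf p) (vec_lambda (vec_nth a))"
    by simp
  also have "\<dots> = pmf (Pi_pmf UNIV 0 (\<lambda>_. B_pmf p)) (vec_nth a)"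
    unfolding B_vec_pmf_def by (rule pmf_map_inj'[OF inj])
  also have "\<dots> = (\<Prod>i\<in>UNIV. pmf (B_pmf p) (a $ i))"
    by (rule pmf_Pi') auto
  finally show ?thesis
    by (simp add: pmf_B_pmf[OF assms])
qed

lemma prob_noisy_hamming_weight:
  fixes b :: "bit ^ 'n"
  assumes "0 \<le> p" "p \<le> 1"
  shows "(\<Sum>a\<in>UNIV. pmf (B_vec_pmf p) a * of_bool (hamming_weight (a + b) = m)) =
    coeff (gen_poly p (1 - p) (hamming_weight b) (CARD('n) - hamming_weight b)) m"
proof -
  \<comment> \<open>\<open>f i\<close> and \<open>g i\<close> are the probabilities that coordinate
    \<open>i\<close> of \<open>a + b\<close> is 1 and 0.\<close>
  define f where "f i = (if b $ i = 1 then p else 1 - p)" for i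
  define g where "g i = (if b $ i = 1 then 1 - p else p)" for i
  \<comment> \<open>Translation by \<open>b\<close> is a bijection, so the sum over the noise
    \<open>a\<close> becomes a sum over the support of the noisy vector.\<close>
  have bij: "bij (\<lambda>a. supp (a + b))"
    using bij_comp[OF _ bij_supp, of "\<lambda>a. a + b"] by (simp add: o_def bij_def inj_def surj_def)
  have factor: "(if a $ i = 0 then p else 1 - p) = (if i \<in> supp (a + b) then f i else g i)" for a i
    by (cases "a $ i"; cases "b $ i") (simp_all add: supp_def f_def g_def)
  have "(\<Sum>a\<in>UNIV. pmf (B_vec_pmf p) a * of_bool (hamming_weight (a + b) = m)) =
    (\<Sum>a\<in>UNIV. (\<Prod>i\<in>UNIV. if i \<in> supp (a + b) then f i else g i) * of_bool (card (supp (a + b)) = m))"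
    by (simp only: pmf_B_vec_pmf[OF assms] factor hamming_weight_supp)
  also have "\<dots> = (\<Sum>X\<in>UNIV. (\<Prod>i\<in>UNIV. if i \<in> X then f i else g i) * of_bool (card X = m))"
    by (rule sum.reindex_bij_betw[OF bij])
  also have "\<dots> = (\<Sum>X | X \<subseteq> UNIV \<and> card X = m. \<Prod>i\<in>UNIV. if i \<in> X then f i else g i)"
    by (intro sum.mono_neutral_cong_right) auto
  also have "\<dots> = coeff (\<Prod>i\<in>UNIV. [:g i, f i:]) m"
    by (rule prod_linear_poly_coeff[symmetric]) simp
  also have "(\<Prod>i\<in>UNIV. [:g i, f i:]) = (\<Prod>i\<in>UNIV. if i \<in> supp b then [:1 - p, p:] else [:p, 1 - p:])"
    by (intro prod.cong) (auto simp: f_def g_def supp_def)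
  also have "\<dots> = gen_poly p (1 - p) (hamming_weight b) (CARD('n) - hamming_weight b)"
    by (simp add: prod.If_cases gen_poly_def hamming_weight_supp Compl_eq_Diff_UNIV card_Diff_subset)
  finally show ?thesis .
qed

lemma integrable_pmf_finite_type [simp]:
  fixes D :: "'a::finite pmf" and f :: "'a \<Rightarrow> real"
  shows "integrable (measure_pmf D) f"
  by (rule integrable_measure_pmf_finite) simp

lemma expectation_finite_type:
  fixes D :: "'a::finite pmf" and f :: "'a \<Rightarrow> real"
  shows "measure_pmf.expectation D f = (\<Sum>x\<in>UNIV. pmf D x * f x)"
  by (subst integral_measure_pmf[of UNIV]) auto

lemma lam_sym_pred:
  fixes D :: "(bit ^ 'n) pmf"
  assumes "0 \<le> p" "p \<le> 1"
  shows "lam (sym_pred {m}) D p = measure_pmf.expectation D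
    (\<lambda>b. coeff (gen_poly p (1 - p) (hamming_weight b) (CARD('n) - hamming_weight b)) m)"
proof -
  have "lam (sym_pred {m}) D p =
    (\<Sum>b\<in>UNIV. \<Sum>a\<in>UNIV. pmf D b * pmf (B_vec_pmf p) a * of_bool (hamming_weight (a + b) = m))"
    unfolding lam_def expectation_finite_type sum.cartesian_product
    by (intro sum.cong) (auto simp: pmf_pair sym_pred_def)
  also have "\<dots> = (\<Sum>b\<in>UNIV. pmf D b *
      (\<Sum>a\<in>UNIV. pmf (B_vec_pmf p) a * of_bool (hamming_weight (a + b) = m)))"
    by (simp only: sum_distrib_left mult.assoc)
  finally show ?thesis
    unfolding prob_noisy_hamming_weight[OF assms] expectation_finite_type .
qed

lemma gam_sym_pred:
  fixes D :: "(bit ^ 'n) pmf"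
  shows "gam (sym_pred {m}) D = measure_pmf.expectation D (\<lambda>b. of_bool (hamming_weight b = m))"
proof -
  \<comment> \<open>At \<open>p = 1\<close> there is no noise, and the weight stays
    \<open>a\<close>.\<close>
  have "gen_poly 1 0 a b = monom 1 a" for a b :: nat
    by (simp add: gen_poly_def monom_altdef one_pCons[symmetric])
  then show ?thesis
    by (simp add: gam_def lam_sym_pred of_bool_def eq_commute)
qed

lemma lam_le_bet:
  assumes "p \<in> {0..1}"
  shows "lam f D p \<le> bet f D"
  unfolding bet_def
proof (rule cSUP_upper[OF assms])
  \<comment> \<open>The supremum is taken in the reals, so an upper bound is required.\<close>
  have "lam f D q \<le> 1" for q
    unfolding lam_def by (rule measure_pmf.integral_le_const) auto
  then show "bdd_above (lam f D ` {0..1})"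
    by (auto simp: bdd_above_def)
qed

lemma neg_sign_eq: "- ((- 1) ^ of_bool P) = (2 * of_bool P - 1 :: real)"
  by (cases P) auto

text \<open>Equal marginals therefore force equal expected weight, which is all that the expectation
  of an affine function of the weight depends on.\<close>

lemma sum_mu:
  fixes D :: "(bit ^ 'n) pmf"
  shows "(\<Sum>i\<in>UNIV. mu D $ i) = 2 * measure_pmf.expectation D (\<lambda>b. real (hamming_weight b)) - CARD('n)"
proof -
  have "mu D $ i = measure_pmf.expectation D (\<lambda>b. 2 * of_bool (b $ i = 1) - 1)" for i
    unfolding mu_def neg_sign_eq[symmetric] by simp
  then have "(\<Sum>i\<in>UNIV. mu D $ i) = measure_pmf.expectation D (\<lambda>b. \<Sum>i\<in>UNIV. 2 * of_bool (b $ i = 1) - 1)"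
    by (simp add: Bochner_Integration.integral_sum)
  also have "(\<lambda>b :: bit ^ 'n. \<Sum>i\<in>UNIV. 2 * of_bool (b $ i = 1) - 1 :: real) =
      (\<lambda>b. 2 * real (hamming_weight b) - CARD('n))"
    by (simp add: fun_eq_iff sum_subtractf sum_distrib_left[symmetric] hamming_weight_def of_bool_def sum.If_cases)
  finally show ?thesis
    by simp
qed

section \<open>The maximiser and the properties of \<open>p'\<close>\<close>

text \<open>\<open>stationary\<close> says that the logarithmic derivative vanishes at
  \<open>e\<close>. Bounding the ratio of each factor by \<open>z \<le> exp (z - 1)\<close> then
  leaves the exponent \<open>- N (t - e)\<^sup>2 / (1 - e\<^sup>2)\<close>, which is at most
  0.\<close>

lemma product_maximum:
  fixes e t :: real and N :: nat
  assumes e: "- 1 < e" "e < 1" and t: "- 1 \<le> t" "t \<le> 1"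
    and stationary: "2 * real N * e * (c + e) = 1 - e\<^sup>2" and c: "1 \<le> c"
  shows "(1 - t\<^sup>2) ^ N * (c + t) \<le> (1 - e\<^sup>2) ^ N * (c + e)"
proof -
  define X where "X = 1 - e\<^sup>2"
  have X: "0 < X"
    using e by (simp add: X_def abs_square_less_1)
  have Y: "0 < c + e"
    using e c by linarith
  have t2: "0 \<le> 1 - t\<^sup>2"
    using t by (simp add: abs_square_le_1)
  have le_exp: "z \<le> exp (z - 1)" for z :: real
    using exp_ge_add_one_self[of "z - 1"] by simp
  have "((1 - t\<^sup>2) / X) ^ N * ((c + t) / (c + e)) \<le> exp ((1 - t\<^sup>2) / X - 1) ^ N * exp ((c + t) / (c + e) - 1)"
    using X Y t c t2 by (intro mult_mono power_mono le_exp) auto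
  also have "\<dots> = exp (N * ((1 - t\<^sup>2) / X - 1) + ((c + t) / (c + e) - 1))"
    by (simp add: exp_add exp_of_nat_mult)
  also have "N * ((1 - t\<^sup>2) / X - 1) + ((c + t) / (c + e) - 1) = - N * (t - e)\<^sup>2 / X"
  proof -
    have "(c + t) / (c + e) - 1 = (t - e) / (c + e)"
      using Y by (simp add: field_simps)
    also have "\<dots> = (t - e) * (1 / (c + e))"
      by simp
    also have "1 / (c + e) = 2 * real N * e / X"
      using X Y stationary unfolding X_def[symmetric] by (simp add: field_simps)
    finally have "(c + t) / (c + e) - 1 = (t - e) * (2 * real N * e / X)" .
    moreover have "1 - t\<^sup>2 = (e\<^sup>2 - t\<^sup>2) + X"
      by (simp add: X_def)
    then have "(1 - t\<^sup>2) / X - 1 = (e\<^sup>2 - t\<^sup>2) / X"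
      using X by (simp only: add_divide_distrib) simp
    ultimately show ?thesis
      using X by (simp only:) (simp add: field_simps power2_eq_square)
  qed
  also have "exp (- N * (t - e)\<^sup>2 / X) \<le> 1"
    using X by (simp add: divide_nonpos_pos)
  finally have "((1 - t\<^sup>2) / X) ^ N * ((c + t) / (c + e)) \<le> 1" .
  then show ?thesis
    using X Y by (simp add: X_def[symmetric] power_divide pos_divide_le_eq)
qed

text \<open>The quadratic equation is the stationarity condition of \<open>product_maximum\<close>
  with \<open>c = k\<close> and \<open>N = (k - 1) / 2\<close>. The bounds on \<open>e\<close> place
  \<open>p' k\<close> above \<open>1 / 2\<close> and at most at \<open>(k + 1) / (2 k)\<close>,
  inside the range where concavity holds.\<close>

lemma p'_properties:
  fixes k :: nat and e :: real
  assumes "2 \<le> k"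
  defines "e \<equiv> 2 * p' k - 1"
  shows "real k * e\<^sup>2 + real k * (real k - 1) * e = 1" and "0 < e" and "real k * e \<le> 1"
proof -
  define K where "K = real k"
  have K: "2 \<le> K"
    using assms by (simp add: K_def)
  define s where "s = sqrt (4 * K + K ^ 2 - 2 * K ^ 3 + K ^ 4)"
  have radicand: "4 * K + K ^ 2 - 2 * K ^ 3 + K ^ 4 = 4 * K + (K * (K - 1))\<^sup>2"
    by (simp add: algebra_simps power2_eq_square power3_eq_cube power4_eq_xxxx)
  have s_sq: "s\<^sup>2 = 4 * K + (K * (K - 1))\<^sup>2"
    unfolding s_def radicand using K by simp
  have "p' k = (3 * K - K\<^sup>2 + s) / (4 * K)"
    by (simp add: p'_def K_def s_def)
  then have s: "s = 2 * K * e + K * (K - 1)"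
    using K unfolding e_def by (simp add: field_simps power2_eq_square)
  have "4 * K * (K * e\<^sup>2 + K * (K - 1) * e) = s\<^sup>2 - (K * (K - 1))\<^sup>2"
    unfolding s by (simp add: algebra_simps power2_eq_square)
  also have "\<dots> = 4 * K * 1"
    using s_sq by simp
  finally have root: "K * e\<^sup>2 + K * (K - 1) * e = 1"
    using K by (subst (asm) mult_cancel_left) auto
  then show "real k * e\<^sup>2 + real k * (real k - 1) * e = 1"
    using assms by (simp add: K_def)
  have "(K * (K - 1))\<^sup>2 < s\<^sup>2"
    using s_sq K by simp
  then have "K * (K - 1) < s"
    by (rule power_less_imp_less_base) (use K in \<open>simp add: s_def radicand\<close>)
  then show "0 < e"
    using K s by (simp add: zero_less_mult_iff)
  \<comment> \<open>Dropping the square from \<open>root\<close> bounds the left side by 1, and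
    \<open>K - 1\<close> is at least 1.\<close>
  have "(K - 1) * (K * e) \<le> (K - 1) * 1"
    using root K by (smt (verit) mult.commute mult.left_commute mult_nonneg_nonneg zero_le_power2)
  then show "real k * e \<le> 1"
    using K by (subst (asm) mult_le_cancel_left_pos) (auto simp: K_def)
qed

section \<open>Constant vectors and weight layers: the distributions for the upper bound\<close>

lemma coeff_gen_poly_zero_left:
  assumes "m \<le> k"
  shows "coeff (gen_poly p q 0 k) m = real (k choose m) * q ^ m * p ^ (k - m)"
  unfolding gen_poly_def using coeff_linear_poly_power[OF assms, of p q] by simp

lemma coeff_gen_poly_zero_right:
  assumes "m \<le> k"
  shows "coeff (gen_poly p q k 0) m = real (k choose m) * p ^ m * q ^ (k - m)"
  unfolding gen_poly_def using coeff_linear_poly_power[OF assms, of q p] by simp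

text \<open>The witness is uniform on the layer of weight \<open>m\<close>; by symmetry each
  coordinate is 1 with probability \<open>m / k\<close>.\<close>

lemma exists_pmf_hamming_weight:
  assumes "m \<le> CARD('n)"
  obtains D :: "(bit ^ 'n) pmf"
  where "gam (sym_pred {m}) D = 1" "\<And>i. mu D $ i = 2 * real m / real CARD('n) - 1"
proof
  let ?k = "CARD('n)"
  define S where "S = {a :: bit ^ 'n. hamming_weight a = m}"
  define D where "D = pmf_of_set S"
  have card_S: "card S = ?k choose m"
    unfolding S_def by (rule card_hamming_weight_eq)
  then have pos: "0 < card S"
    using assms by (simp add: zero_less_binomial_iff)
  then have S: "S \<noteq> {}" "finite S"
    unfolding card_gt_0_iff by auto
  have "(\<Sum>b\<in>S. of_bool (hamming_weight b = m)) = real (card S)"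
    by (simp add: S_def)
  then show "gam (sym_pred {m}) D = 1"
    using pos by (simp add: gam_sym_pred D_def integral_pmf_of_set S)
  show "mu D $ i = 2 * real m / real ?k - 1" for i
  proof -
    have "(\<Sum>a\<in>S. (- 1) ^ of_bool (a $ i = 1)) = (\<Sum>a\<in>S. 2 * of_bool (a $ i = 0) - 1 :: real)"
      by (intro sum.cong) auto
    also have "\<dots> = 2 * real (card {a \<in> S. a $ i = 0}) - real (card S)"
      using S by (simp add: sum_subtractf sum_distrib_left[symmetric] of_bool_def sum.If_cases Int_def)
    also have "card {a \<in> S. a $ i = 0} = (?k - 1) choose m"
      unfolding S_def using card_hamming_weight_eq_nth_zero[of m i] by simp
    finally have sum: "(\<Sum>a\<in>S. (- 1) ^ of_bool (a $ i = 1)) = 2 * real ((?k - 1) choose m) - real (card S)" .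
    have "real (?k * ((?k - 1) choose m)) = real ((?k - m) * card S)"
      using binomial_absorb_comp[of ?k m] unfolding card_S by simp
    then have "real ((?k - 1) choose m) / card S = (real ?k - m) / ?k"
      using pos assms by (subst frac_eq_eq) (simp_all add: S mult_ac of_nat_diff)
    moreover have "mu D $ i = 1 - 2 * (real ((?k - 1) choose m) / card S)"
      using pos by (simp add: mu_def D_def integral_pmf_of_set S sum diff_divide_distrib)
    ultimately show ?thesis
      by (simp only:) (simp add: diff_divide_distrib)
  qed
qed

text \<open>The witness is the all-ones vector with probability \<open>m / k\<close> and the
  all-zeros vector otherwise.\<close>

lemma exists_pmf_constant_vectors:
  assumes "m \<le> CARD('n)"
  obtains D :: "(bit ^ 'n) pmf"
  where "\<And>i. mu D $ i = 2 * real m / real CARD('n) - 1"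
    and "\<And>p. 0 \<le> p \<Longrightarrow> p \<le> 1 \<Longrightarrow> real CARD('n) * lam (sym_pred {l}) D p =
      real (CARD('n) - m) * coeff (gen_poly p (1 - p) 0 CARD('n)) l +
      real m * coeff (gen_poly p (1 - p) CARD('n) 0) l"
proof
  let ?k = "CARD('n)"
  define r where "r = real m / ?k"
  have r: "0 \<le> r" "r \<le> 1"
    using assms by (simp_all add: r_def)
  define D :: "(bit ^ 'n) pmf" where "D = map_pmf (\<lambda>h. if h then 1 else 0) (bernoulli_pmf r)"
  have weights: "hamming_weight (1 :: bit ^ 'n) = ?k" "hamming_weight (0 :: bit ^ 'n) = 0"
    by (simp_all add: hamming_weight_def)
  show "mu D $ i = 2 * real m / real ?k - 1" for i
    using r by (simp add: mu_def D_def) (simp add: r_def)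
  show "real ?k * lam (sym_pred {l}) D p = real (?k - m) * coeff (gen_poly p (1 - p) 0 ?k) l +
      real m * coeff (gen_poly p (1 - p) ?k 0) l" if "0 \<le> p" "p \<le> 1" for p
    using r that assms by (simp add: lam_sym_pred D_def weights) (simp add: r_def of_nat_diff field_simps)
qed

section \<open>Lower and upper bounds on \<open>alpha\<close>\<close>

lemma alpha_lower_bound:
  fixes p :: real
  assumes k: "CARD('n) = 2 * n + 3" and p: "1 / 2 \<le> p" "(2 * n + 3) * p \<le> n + 2"
  defines "P \<equiv> \<lambda>i. coeff (gen_poly p (1 - p) i (CARD('n) - i)) (n + 2)"
  shows "ereal ((real (n + 1) * P 0 + real (n + 2) * P CARD('n)) / real (2 * n + 3))
    \<le> alpha (sym_pred {n + 2} :: bit ^ 'n \<Rightarrow> bool)"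
proof -
  let ?k = "CARD('n)" and ?f = "sym_pred {n + 2} :: bit ^ 'n \<Rightarrow> bool"
  let ?V = "(real (n + 1) * P 0 + real (n + 2) * P ?k) / real (2 * n + 3)"
  \<comment> \<open>\<open>L\<close> is the chord of \<open>P\<close> through 0 and
    \<open>k\<close>; at \<open>n + 2\<close> it takes the claimed value, since
    \<open>k - (n + 2) = n + 1\<close>.\<close>
  define L where "L i = (real (?k - i) * P 0 + real i * P ?k) / ?k" for i
  have "real (2 * n + 3) * p < real (2 * n + 3) * 1"
    using p(2) by (simp add: algebra_simps)
  then have p1: "p < 1"
    by (subst (asm) mult_less_cancel_left_pos) auto
  have concave: "P (Suc (Suc i)) + P i \<le> 2 * P (Suc i)" if "Suc i < ?k" for i
  proof -
    define b where "b = ?k - Suc (Suc i)"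
    have b: "?k - i = Suc (Suc b)" "?k - Suc i = Suc b" "i + b = 2 * n + 1"
      using that k by (auto simp: b_def)
    show ?thesis
      unfolding P_def b b_def[symmetric] using p p1 b(3)
      by (intro coeff_gen_poly_concave) (auto simp: algebra_simps)
  qed
  have chord: "L i \<le> P i" if "i \<le> ?k" for i
    using discrete_concave_above_chord[of ?k P, OF concave that] by (simp add: L_def field_simps)
  have "0 \<le> P i" for i
    unfolding P_def using p p1 by (intro coeff_gen_poly_nonneg) auto
  then have L_nonneg: "0 \<le> L i" for i
    by (simp add: L_def)
  have L_mid: "L (n + 2) = ?V"
    by (simp add: L_def k)
  have expectation_L: "measure_pmf.expectation D (\<lambda>b. L (hamming_weight b)) =
      P 0 + (P ?k - P 0) / ?k * measure_pmf.expectation D (\<lambda>b. real (hamming_weight b))"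
    for D :: "(bit ^ 'n) pmf"
  proof -
    have "L (hamming_weight b) = P 0 + (P ?k - P 0) / ?k * real (hamming_weight b)" for b :: "bit ^ 'n"
      using hamming_weight_le[of b] by (simp add: L_def of_nat_diff field_simps)
    then show ?thesis
      by simp
  qed
  have bound: "?V * gam ?f D\<^sub>Y \<le> bet ?f D\<^sub>N" if "mu D\<^sub>N = mu D\<^sub>Y" for D\<^sub>N D\<^sub>Y :: "(bit ^ 'n) pmf"
  proof -
    have "?V * gam ?f D\<^sub>Y = measure_pmf.expectation D\<^sub>Y (\<lambda>b. ?V * of_bool (hamming_weight b = n + 2))"
      by (simp add: gam_sym_pred)
    \<comment> \<open>At weight \<open>n + 2\<close> both integrands agree; at every other weight
      the left one is 0 and the chord is nonnegative.\<close>
    also have "\<dots> \<le> measure_pmf.expectation D\<^sub>Y (\<lambda>b. L (hamming_weight b))"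
      using L_nonneg L_mid by (intro integral_mono) (auto simp: of_bool_def)
    also have "\<dots> = measure_pmf.expectation D\<^sub>N (\<lambda>b. L (hamming_weight b))"
      unfolding expectation_L using sum_mu[of D\<^sub>N] sum_mu[of D\<^sub>Y] that by simp
    also have "\<dots> \<le> measure_pmf.expectation D\<^sub>N (\<lambda>b. P (hamming_weight b))"
      by (intro integral_mono chord hamming_weight_le) auto
    also have "\<dots> = lam ?f D\<^sub>N p"
      using p p1 by (subst lam_sym_pred) (auto simp: P_def)
    also have "\<dots> \<le> bet ?f D\<^sub>N"
      using p p1 by (intro lam_le_bet) auto
    finally show ?thesis .
  qed
  have gam_nonneg: "0 \<le> gam ?f D" for D
    by (simp add: gam_sym_pred)
  show ?thesis
    unfolding alpha_def
  proof (intro INF_greatest, clarify)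
    fix D\<^sub>N D\<^sub>Y :: "(bit ^ 'n) pmf"
    assume "mu D\<^sub>N = mu D\<^sub>Y"
    then show "ereal ?V \<le> (if gam ?f D\<^sub>Y = 0 then \<infinity> else ereal (bet ?f D\<^sub>N / gam ?f D\<^sub>Y))"
      using bound gam_nonneg[of D\<^sub>Y] by (auto simp: pos_le_divide_eq less_le)
  qed
qed

text \<open>The layer distribution has \<open>gam\<close> equal to 1, so the ratio is
  \<open>bet\<close> of the mixture of constant vectors, and the hypothesis bounds its
  \<open>lam\<close> at every noise level.\<close>

lemma alpha_upper_bound:
  assumes "m \<le> CARD('n)"
    and "\<And>p. 0 \<le> p \<Longrightarrow> p \<le> 1 \<Longrightarrow> real (CARD('n) - m) * coeff (gen_poly p (1 - p) 0 CARD('n)) m +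
      real m * coeff (gen_poly p (1 - p) CARD('n) 0) m \<le> real CARD('n) * V"
  shows "alpha (sym_pred {m} :: bit ^ 'n \<Rightarrow> bool) \<le> ereal V"
proof -
  let ?f = "sym_pred {m} :: bit ^ 'n \<Rightarrow> bool"
  obtain D\<^sub>Y :: "(bit ^ 'n) pmf" where Y: "gam ?f D\<^sub>Y = 1" "\<And>i. mu D\<^sub>Y $ i = 2 * real m / real CARD('n) - 1"
    using exists_pmf_hamming_weight[OF assms(1)] by blast
  obtain D\<^sub>N :: "(bit ^ 'n) pmf" where N: "\<And>i. mu D\<^sub>N $ i = 2 * real m / real CARD('n) - 1"
    "\<And>p. 0 \<le> p \<Longrightarrow> p \<le> 1 \<Longrightarrow> real CARD('n) * lam ?f D\<^sub>N p =
      real (CARD('n) - m) * coeff (gen_poly p (1 - p) 0 CARD('n)) m +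
      real m * coeff (gen_poly p (1 - p) CARD('n) 0) m"
    using exists_pmf_constant_vectors[OF assms(1), where l = m] by blast
  have "bet ?f D\<^sub>N \<le> V"
    unfolding bet_def
  proof (rule cSUP_least)
    fix p :: real
    assume "p \<in> {0..1}"
    then have "real CARD('n) * lam ?f D\<^sub>N p \<le> real CARD('n) * V"
      using N(2) assms(2) by simp
    then show "lam ?f D\<^sub>N p \<le> V"
      by (subst (asm) mult_le_cancel_left_pos) auto
  qed simp
  moreover have "mu D\<^sub>N = mu D\<^sub>Y"
    by (simp add: vec_eq_iff N(1) Y(2))
  then have "alpha ?f \<le> (if gam ?f D\<^sub>Y = 0 then \<infinity> else ereal (bet ?f D\<^sub>N / gam ?f D\<^sub>Y))"
    unfolding alpha_def by (intro INF_lower2[of "(D\<^sub>N, D\<^sub>Y)"]) auto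
  ultimately show ?thesis
    using Y(1) by (simp add: order_trans)
qed

section \<open>Maximising the mixture and the exact value\<close>

lemma mixture_maximum:
  fixes n :: nat and p p0 :: real
  defines "F \<equiv> \<lambda>p :: real. (n + 1) * ((1 - p) ^ (n + 2) * p ^ (n + 1)) + (n + 2) * (p ^ (n + 2) * (1 - p) ^ (n + 1))"
  assumes p: "0 \<le> p" "p \<le> 1" and p0: "0 < p0" "p0 < 1"
    and root: "(2 * n + 3) * (2 * p0 - 1)\<^sup>2 + (2 * n + 3) * (2 * n + 2) * (2 * p0 - 1) = 1"
  shows "F p \<le> F p0"
proof -
  \<comment> \<open>The substitution \<open>t = 2 * x - 1\<close> turns \<open>4 x (1 - x)\<close>
    into \<open>1 - t\<^sup>2\<close>, so that \<open>product_maximum\<close> applies with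
    \<open>N = n + 1\<close> and \<open>c = 2 n + 3\<close>.\<close>
  have F: "2 * 4 ^ (n + 1) * F x = (1 - (2 * x - 1)\<^sup>2) ^ (n + 1) * (real (2 * n + 3) + (2 * x - 1))" for x
  proof -
    have "1 - (2 * x - 1)\<^sup>2 = 4 * (x * (1 - x))"
      by (simp add: power2_eq_square algebra_simps)
    moreover have "2 * ((n + 1) * (y ^ (n + 2) * x ^ (n + 1)) + (n + 2) * (x ^ (n + 2) * y ^ (n + 1))) =
        (x * y) ^ (n + 1) * (2 * ((n + 1) * y + (n + 2) * x))" for y :: real
      by (simp add: power_mult_distrib algebra_simps)
    then have "2 * F x = (x * (1 - x)) ^ (n + 1) * (2 * ((n + 1) * (1 - x) + (n + 2) * x))"
      unfolding F_def .
    moreover have "2 * ((n + 1) * (1 - x) + (n + 2) * x) = real (2 * n + 3) + (2 * x - 1)"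
      by (simp add: algebra_simps)
    ultimately show ?thesis
      by (simp only: power_mult_distrib) (simp add: mult_ac)
  qed
  have "(1 - (2 * p - 1)\<^sup>2) ^ (n + 1) * (real (2 * n + 3) + (2 * p - 1))
      \<le> (1 - (2 * p0 - 1)\<^sup>2) ^ (n + 1) * (real (2 * n + 3) + (2 * p0 - 1))"
  proof (rule product_maximum)
    show "2 * real (n + 1) * (2 * p0 - 1) * (real (2 * n + 3) + (2 * p0 - 1)) = 1 - (2 * p0 - 1)\<^sup>2"
      using root by (simp add: algebra_simps power2_eq_square)
  qed (use p p0 in auto)
  then have "2 * 4 ^ (n + 1) * F p \<le> 2 * 4 ^ (n + 1) * F p0"
    by (simp only: F)
  then show ?thesis
    by (subst (asm) mult_le_cancel_left_pos) auto
qed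

theorem theorem7p25:
  fixes k :: nat
  assumes "CARD('n::finite) = k" and "odd k" and "3 \<le> k" and "k \<le> 51"
  shows "alpha (sym_pred {(k + 1) div 2} :: bit ^ 'n \<Rightarrow> bool) =
    ereal (real (k choose ((k + 1) div 2)) *
      ((real k - 1) / (2 * real k) * (1 - p' k) ^ ((k + 1) div 2) * p' k ^ ((k - 1) div 2) +
       (real k + 1) / (2 * real k) * (1 - p' k) ^ ((k - 1) div 2) * p' k ^ ((k + 1) div 2)))"
    (is "_ = ereal ?V")
proof -
  have "\<exists>n. k = 2 * n + 3"
    using assms(2,3) by presburger
  then obtain n where n: "k = 2 * n + 3"
    by blast
  have halves: "(k + 1) div 2 = n + 2" "(k - 1) div 2 = n + 1"
    by (simp_all add: n)
  define p where "p = p' k"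
  have root: "real k * (2 * p - 1)\<^sup>2 + real k * (real k - 1) * (2 * p - 1) = 1"
    and p_half: "1 / 2 < p" and p_le: "real k * p \<le> n + 2"
    using p'_properties[of k] assms(3) unfolding p_def[symmetric] by (auto simp: n algebra_simps)
  have "real k * p < real k * 1"
    using p_le n by linarith
  then have p_less: "p < 1"
    by (subst (asm) mult_less_cancel_left_pos) (auto simp: n)
  \<comment> \<open>\<open>F\<close> is \<open>k\<close> times the claimed expression with the
    binomial coefficient removed and the noise level left free. The upper bound uses
    \<open>F x\<close> for all \<open>x\<close>, the lower bound only \<open>F p\<close>.\<close>
  define F where "F x = (n + 1) * ((1 - x) ^ (n + 2) * x ^ (n + 1)) + (n + 2) * (x ^ (n + 2) * (1 - x) ^ (n + 1))"
    for x :: real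
  have mixture: "real (n + 1) * coeff (gen_poly x (1 - x) 0 k) (n + 2) +
      real (n + 2) * coeff (gen_poly x (1 - x) k 0) (n + 2) = real (k choose (n + 2)) * F x" for x
    by (simp add: coeff_gen_poly_zero_left coeff_gen_poly_zero_right n F_def) (simp add: algebra_simps)
  have V: "?V = real (k choose (n + 2)) * F p / k"
  proof -
    have "(real k - 1) / (2 * real k) = (n + 1) / k" "(real k + 1) / (2 * real k) = (n + 2) / k"
      by (simp_all add: n field_simps)
    moreover have "c * (a / d * x * y + b / d * z * w) = c * (a * (x * y) + b * (w * z)) / d" for a b c d x y z w :: real
      by (simp add: divide_inverse algebra_simps)
    ultimately show ?thesis
      unfolding halves p_def[symmetric] F_def by (simp only:)
  qed
  have "alpha (sym_pred {n + 2} :: bit ^ 'n \<Rightarrow> bool) \<le> ereal ?V"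
  proof (rule alpha_upper_bound)
    fix x :: real
    assume "0 \<le> x" "x \<le> 1"
    then have "F x \<le> F p"
      unfolding F_def using root p_half p_less n by (intro mixture_maximum) (auto simp: algebra_simps)
    moreover have "CARD('n) - (n + 2) = n + 1"
      by (simp add: assms(1) n)
    ultimately show "real (CARD('n) - (n + 2)) * coeff (gen_poly x (1 - x) 0 CARD('n)) (n + 2) +
      real (n + 2) * coeff (gen_poly x (1 - x) CARD('n) 0) (n + 2) \<le> real CARD('n) * ?V"
      unfolding assms(1) V using assms(3) by (simp only: mixture) (simp add: mult_left_mono)
  qed (simp add: assms(1) n)
  moreover have "ereal ?V \<le> alpha (sym_pred {n + 2} :: bit ^ 'n \<Rightarrow> bool)"
  proof -
    have "ereal ((real (n + 1) * coeff (gen_poly p (1 - p) 0 (CARD('n) - 0)) (n + 2) +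
        real (n + 2) * coeff (gen_poly p (1 - p) CARD('n) (CARD('n) - CARD('n))) (n + 2)) / real (2 * n + 3))
      \<le> alpha (sym_pred {n + 2} :: bit ^ 'n \<Rightarrow> bool)"
      using p_half p_le by (intro alpha_lower_bound) (auto simp: assms(1) n)
    then show ?thesis
      unfolding assms(1) diff_zero diff_self_eq_0 mixture V n[symmetric] .
  qed
  ultimately show ?thesis
    unfolding halves by (rule antisym)
qed

end
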